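(* Let $n$ and $\Delta$ be positive integers with $\Delta \geq 81\log n$, and set $q = 3\Delta^{2/3}\log^{1/3} n$ (so that $q \leq \Delta$). For every $n$-node bipartite graph $G$ of maximum degree $\Delta$, revealed in the one-sided vertex arrival model in any (adversarial) order, Algorithm A run with parameter $q$ outputs a valid (proper) edge coloring of $G$ using colors from $\mathcal{C}=[\Delta+q]$ with high probability, i.e. with probability at least $1-n^{-c}$ for some constant $c>0$.
   Context: Here $\log$ is the natural logarithm. One-sided vertex arrival model: $G$ is bipartite with an offline side and an online side. Initially only $n$, $\Delta$ and the offline nodes are known. At time $t=1,2,\dots$ an online node $w_t$ is revealed together with all its edges (to offline nodes), and each of these edges must immediately and irrevocably be assigned a color. For an offline node $v$, $d_t(v)$ denotes the number of edges between $v$ and $w_1,\dots,w_{t-1}$ (its degree before $w_t$ arrives), and $N_G(w_t)$ is the set of (offline) neighbors of $w_t$. Algorithm A with parameter $q>0$ uses the color set $\mathcal{C}=[\Delta+q]$. When $w_t$ arrives: (1) let $H_t$ be the bipartite graph with vertex sets $N_G(w_t)$ and $\mathcal{C}$, in which $v\in N_G(w_t)$ and $c\in\mathcal{C}$ are adjacent iff no edge of $v$ has been colored $c$ so far; (2) for each $c\in\mathcal{C}$ and offline $v$, set $x^t_{cv} = \mathbb{1}[cv\in H_t]/(\Delta-d_t(v)+q)$; (3) if $\sum_v x^t_{cv}\leq 1$ for every color $c\in\mathcal{C}$, sample (with fresh randomness) a random matching $M_t$ of $H_t$ with exact marginals $\Pr[cv\in M_t]=x^t_{cv}$ for all $c,v$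 (such a distribution exists since then $x^t$ lies in the bipartite matching polytope of $H_t$), and color each edge $\{v,w_t\}$ with the color matched to $v$ in $M_t$; (4) otherwise (failure mode), color each edge $\{v,w_t\}$ with a color chosen uniformly at random from the neighbors of $v$ in $H_t$, independently for different $v$.
   Formalization: The number q = 3Δ^{2/3} log^{1/3} n is rounded up to an integer, both in the algorithm and in the color set [Δ+q], since for non-integral q the marginals at an offline node do not sum to 1 and step (3) cannot color all edges. *)

theory Defs
  imports "HOL-Probability.Probability" "HOL-Probability.Product_PMF"
begin

text \<open>
  Offline nodes and online nodes live in two different types; the edge \<open>{v, w}\<close> between an
  offline node \<open>v\<close> and an online node \<open>w\<close> is the pair \<open>(v, w)\<close>.
\<close>

definition bipartite_graph :: "'a set \<Rightarrow> 'b set \<Rightarrow> ('a \<times> 'b) set \<Rightarrow> bool" where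
  "bipartite_graph L R E \<longleftrightarrow> finite L \<and> finite R \<and> E \<subseteq> L \<times> R"

definition offline_nbrs :: "('a \<times> 'b) set \<Rightarrow> 'b \<Rightarrow> 'a set" where
  "offline_nbrs E w = {v. (v, w) \<in> E}"

definition online_nbrs :: "('a \<times> 'b) set \<Rightarrow> 'a \<Rightarrow> 'b set" where
  "online_nbrs E v = {w. (v, w) \<in> E}"

definition max_degree :: "'a set \<Rightarrow> 'b set \<Rightarrow> ('a \<times> 'b) set \<Rightarrow> nat" where
  "max_degree L R E =
     Max ((\<lambda>v. card (online_nbrs E v)) ` L \<union> (\<lambda>w. card (offline_nbrs E w)) ` R)"

text \<open>Partial edge colorings; \<open>None\<close> means that the edge has not been colored.\<close>

type_synonym ('a, 'b) coloring = "'a \<times> 'b \<Rightarrow> nat option"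

definition proper_edge_coloring ::
  "('a \<times> 'b) set \<Rightarrow> nat set \<Rightarrow> ('a, 'b) coloring \<Rightarrow> bool" where
  "proper_edge_coloring E C \<phi> \<longleftrightarrow>
     (\<forall>e\<in>E. \<exists>c\<in>C. \<phi> e = Some c) \<and>
     (\<forall>e\<in>E. \<forall>e'\<in>E. e \<noteq> e' \<and> (fst e = fst e' \<or> snd e = snd e') \<longrightarrow> \<phi> e \<noteq> \<phi> e')"

text \<open>
  The graph \<open>H\<^sub>t\<close>, as a set of pairs (color, offline node), for the arriving node \<open>w\<close> and the
  coloring \<open>\<phi>\<close> of the edges revealed before.
\<close>

definition color_graph ::
  "nat set \<Rightarrow> ('a \<times> 'b) set \<Rightarrow> 'b \<Rightarrow> ('a, 'b) coloring \<Rightarrow> (nat \<times> 'a) set" where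
  "color_graph C E w \<phi> =
     {(c, v). c \<in> C \<and> v \<in> offline_nbrs E w \<and> (\<forall>u. \<phi> (v, u) \<noteq> Some c)}"

definition degree_before :: "('a \<times> 'b) set \<Rightarrow> 'b list \<Rightarrow> 'a \<Rightarrow> nat" where
  "degree_before E us v = card {u \<in> set us. (v, u) \<in> E}"

definition marginal ::
  "nat \<Rightarrow> nat \<Rightarrow> ('a \<Rightarrow> nat) \<Rightarrow> (nat \<times> 'a) set \<Rightarrow> nat \<Rightarrow> 'a \<Rightarrow> real" where
  "marginal \<Delta> q d H c v =
     (if (c, v) \<in> H then 1 / (real \<Delta> - real (d v) + real q) else 0)"

definition bipartite_matching :: "('c \<times> 'a) set \<Rightarrow> ('c \<times> 'a) set \<Rightarrow> bool" where
  "bipartite_matching H M \<longleftrightarrow>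
     M \<subseteq> H \<and> (\<forall>e\<in>M. \<forall>e'\<in>M. e \<noteq> e' \<longrightarrow> fst e \<noteq> fst e' \<and> snd e \<noteq> snd e')"

definition matching_with_marginals ::
  "('c \<times> 'a) set \<Rightarrow> ('c \<Rightarrow> 'a \<Rightarrow> real) \<Rightarrow> ('c \<times> 'a) set pmf \<Rightarrow> bool" where
  "matching_with_marginals H x \<mu> \<longleftrightarrow>
     (\<forall>M\<in>set_pmf \<mu>. bipartite_matching H M) \<and>
     (\<forall>c v. measure_pmf.prob \<mu> {M. (c, v) \<in> M} = x c v)"

definition matched_color :: "(nat \<times> 'a) set \<Rightarrow> 'a \<Rightarrow> nat option" where
  "matched_color M v = (if \<exists>c. (c, v) \<in> M then Some (THE c. (c, v) \<in> M) else None)"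

definition color_edges_at ::
  "'b \<Rightarrow> ('a, 'b) coloring \<Rightarrow> ('a \<Rightarrow> nat option) \<Rightarrow> ('a, 'b) coloring" where
  "color_edges_at w \<phi> f = (\<lambda>(v, u). if u = w then f v else \<phi> (v, u))"

text \<open>
  \<open>algorithm_A_step \<Delta> q E us w \<phi> P\<close>: if \<open>w\<close> arrives after the online nodes \<open>us\<close> and the current
  coloring is \<open>\<phi>\<close>, then \<open>P\<close> is a possible distribution of the coloring after the arrival of \<open>w\<close>.
  This is a relation since the algorithm may use any random matching with the right marginals
  (and may choose that distribution depending on the history). The colors are \<open>1, \<dots>, \<Delta> + q\<close>.
\<close>

definition algorithm_A_step ::
  "nat \<Rightarrow> nat \<Rightarrow> ('a \<times> 'b) set \<Rightarrow> 'b list \<Rightarrow> 'b \<Rightarrow> ('a, 'b) coloring \<Rightarrow>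
   ('a, 'b) coloring pmf \<Rightarrow> bool" where
  "algorithm_A_step \<Delta> q E us w \<phi> P \<longleftrightarrow>
     (let C = {1..\<Delta> + q};
          N = offline_nbrs E w;
          H = color_graph C E w \<phi>;
          x = marginal \<Delta> q (degree_before E us) H
      in if \<forall>c\<in>C. (\<Sum>v\<in>N. x c v) \<le> 1
         then \<exists>\<mu>. matching_with_marginals H x \<mu> \<and>
                P = map_pmf (\<lambda>M. color_edges_at w \<phi> (matched_color M)) \<mu>
         else P = map_pmf (color_edges_at w \<phi>)
                (Pi_pmf N None (\<lambda>v. map_pmf Some (pmf_of_set {c. (c, v) \<in> H}))))"

text \<open>
  \<open>algorithm_A \<Delta> q E ws P\<close>: for some choice of the matching distributions, \<open>P\<close> is the
  distribution of the coloring after the online nodes \<open>ws\<close> have arrived in this order. A step has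
  to be possible only at colorings of positive probability: at other colorings, a matching
  distribution with the required marginals need not exist.
\<close>

inductive algorithm_A ::
  "nat \<Rightarrow> nat \<Rightarrow> ('a \<times> 'b) set \<Rightarrow> 'b list \<Rightarrow> ('a, 'b) coloring pmf \<Rightarrow> bool"
  for \<Delta> :: nat and q :: nat and E :: "('a \<times> 'b) set"
where
  start: "algorithm_A \<Delta> q E [] (return_pmf (\<lambda>_. None))"
| arrival: "algorithm_A \<Delta> q E us P \<Longrightarrow>
     (\<And>\<phi>. \<phi> \<in> set_pmf P \<Longrightarrow> algorithm_A_step \<Delta> q E us w \<phi> (K \<phi>)) \<Longrightarrow>
     algorithm_A \<Delta> q E (us @ [w]) (bind_pmf P K)"

end

theory Submission
  imports Defs
begin

text \<open>
  In both modes of the algorithm a color \<open>c\<close> that is free at \<open>v\<close> is used on the next edge of \<open>v\<close>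
  with probability \<open>1 / D\<^sub>v\<close>, where \<open>D\<^sub>v = \<Delta> - d(v) + q\<close>, and the events for different \<open>v\<close> are either
  disjoint or independent. Hence for \<open>h(D) = 1 / (\<alpha> D + 1)\<close> with \<open>0 \<le> \<alpha> \<le> 1\<close> the product of
  \<open>exp (h(D\<^sub>v))\<close> over those neighbors \<open>v\<close> of a fixed online node at which \<open>c\<close> is free is a
  supermartingale, no matter whether failures occur. The additive \<open>1\<close> in the denominator
  pays for the variance, so that no concentration inequality for martingales is needed. If \<open>c\<close>
  makes the algorithm fail at the arrival of that node, then the product is at least \<open>exp (q / (\<alpha> q + 1))\<close>.
  For \<open>\<alpha> = (2 \<Delta> - q) / q\<^sup>2\<close>, Markov's inequality bounds the probability of this by
  \<open>exp (- q\<^sup>3 / (2 \<Delta> (2 \<Delta> + q))) \<le> n powr (- 9/2)\<close>, and a union bound over nodes and colors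
  finishes the proof: without failures, the coloring is proper.
\<close>

section \<open>Expectations over finitely supported distributions\<close>

lemma expectation_bind_pmf_finite:
  fixes h :: "'b \<Rightarrow> real"
  assumes "finite (set_pmf p)" "\<And>x. x \<in> set_pmf p \<Longrightarrow> finite (set_pmf (K x))"
  shows "measure_pmf.expectation (bind_pmf p K) h =
    measure_pmf.expectation p (\<lambda>x. measure_pmf.expectation (K x) h)"
proof -
  have "measure_pmf.expectation (bind_pmf p K) h =
      (\<Sum>x\<in>set_pmf p. pmf p x *\<^sub>R measure_pmf.expectation (K x) h)"
    using assms by (intro pmf_expectation_bind) auto
  also have "\<dots> = measure_pmf.expectation p (\<lambda>x. measure_pmf.expectation (K x) h)"
    using assms(1) by (subst integral_measure_pmf[of "set_pmf p"]) auto
  finally show ?thesis .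
qed

lemma expectation_mono_finite:
  fixes f g :: "'a \<Rightarrow> real"
  assumes "finite (set_pmf p)" "\<And>x. x \<in> set_pmf p \<Longrightarrow> f x \<le> g x"
  shows "measure_pmf.expectation p f \<le> measure_pmf.expectation p g"
  using assms by (intro integral_mono_AE integrable_measure_pmf_finite) (auto simp: AE_measure_pmf_iff)

section \<open>One moment bound for the matching mode and the failure mode\<close>

text \<open>
  The last conjunct is the moment bound for a sum of independent indicators with means \<open>1 / D v\<close>.
  Disjoint indicators, as in a random matching, satisfy it as well, so that both modes of the
  algorithm can be treated alike.
\<close>

definition fair_choice ::
  "(nat \<times> 'a) set \<Rightarrow> 'a set \<Rightarrow> ('a \<Rightarrow> real) \<Rightarrow> ('a \<Rightarrow> nat option) pmf \<Rightarrow> bool" where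
  "fair_choice H N D F \<longleftrightarrow>
     finite (set_pmf F) \<and>
     (\<forall>f\<in>set_pmf F. \<forall>v. if v \<in> N then \<exists>c. f v = Some c \<and> (c, v) \<in> H else f v = None) \<and>
     (\<forall>c T g. T \<subseteq> N \<longrightarrow> (\<forall>v\<in>T. (c, v) \<in> H) \<longrightarrow>
        measure_pmf.expectation F (\<lambda>f. \<Prod>v\<in>T. if f v = Some c then 1 else exp (g v))
        \<le> (\<Prod>v\<in>T. exp (g v + (exp (- g v) - 1) / D v)))"

lemma matched_color_eq_Some_iff:
  assumes "bipartite_matching H M"
  shows "matched_color M v = Some c \<longleftrightarrow> (c, v) \<in> M"
proof -
  have uniq: "c' = c''" if "(c', v) \<in> M" "(c'', v) \<in> M" for c' c''
    using assms that unfolding bipartite_matching_def by fastforce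
  show ?thesis
    using uniq by (auto simp: matched_color_def intro!: the_equality) (metis theI)
qed

text \<open>For a fixed color the events of being matched to different nodes are disjoint, so the
  product is affine in their indicators and its expectation depends on the marginals alone. The
  inequality 1 + y \<le> exp y then turns the resulting sum into the product bound.\<close>

lemma fair_choice_matching:
  fixes D :: "'a \<Rightarrow> real"
  assumes fin: "finite H" "finite N" and sub: "\<And>c v. (c, v) \<in> H \<Longrightarrow> v \<in> N"
    and D: "\<And>v. v \<in> N \<Longrightarrow> D v > 0" "\<And>v. v \<in> N \<Longrightarrow> real (card {c. (c, v) \<in> H}) = D v"
    and x: "\<And>c v. x c v = (if (c, v) \<in> H then 1 / D v else 0)"
    and mu: "matching_with_marginals H x \<mu>"
  shows "fair_choice H N D (map_pmf matched_color \<mu>)"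
proof -
  have M: "bipartite_matching H M" if "M \<in> set_pmf \<mu>" for M
    using mu that by (auto simp: matching_with_marginals_def)
  have prob: "measure_pmf.prob \<mu> {M. (c, v) \<in> M} = x c v" for c v
    using mu by (auto simp: matching_with_marginals_def)
  have MH: "M \<subseteq> H" if "M \<in> set_pmf \<mu>" for M
    using M[OF that] by (auto simp: bipartite_matching_def)
  have finmu: "finite (set_pmf \<mu>)"
    by (rule finite_subset[of _ "Pow H"]) (use MH fin in auto)
  have int: "integrable (measure_pmf \<mu>) (h :: _ \<Rightarrow> real)" for h
    using finmu by (rule integrable_measure_pmf_finite)
  \<comment> \<open>The marginals at \<open>v\<close> are \<open>1 / D v\<close> for each of its
    \<open>D v\<close> free colors, and these events are disjoint in a matching. They therefore sum
    to 1, and \<open>v\<close> is matched in every matching of the support.\<close>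
  have matched: "\<exists>c. (c, v) \<in> M" if v: "v \<in> N" and MM: "M \<in> set_pmf \<mu>" for v M
  proof -
    let ?S = "{c. (c, v) \<in> H}"
    have finS: "finite ?S"
      by (rule finite_subset[of _ "fst ` H"]) (use fin in force)+
    have "measure_pmf.prob \<mu> (\<Union>c\<in>?S. {M \<in> set_pmf \<mu>. (c, v) \<in> M}) =
        (\<Sum>c\<in>?S. measure_pmf.prob \<mu> {M \<in> set_pmf \<mu>. (c, v) \<in> M})"
    proof (rule measure_pmf.finite_measure_finite_Union)
      show "disjoint_family_on (\<lambda>c. {M \<in> set_pmf \<mu>. (c, v) \<in> M}) ?S"
        using M unfolding disjoint_family_on_def bipartite_matching_def by fastforce
    qed (use finS in auto)
    also have "\<dots> = (\<Sum>c\<in>?S. x c v)"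
    proof (rule sum.cong[OF refl])
      fix c
      have "measure_pmf.prob \<mu> {M \<in> set_pmf \<mu>. (c, v) \<in> M} = measure_pmf.prob \<mu> {M. (c, v) \<in> M}"
        by (rule measure_pmf.finite_measure_eq_AE) (auto simp: AE_measure_pmf_iff)
      then show "measure_pmf.prob \<mu> {M \<in> set_pmf \<mu>. (c, v) \<in> M} = x c v"
        by (simp add: prob)
    qed
    also have "\<dots> = 1"
      using D[OF v] by (simp add: x)
    finally have "AE M in measure_pmf \<mu>. M \<in> (\<Union>c\<in>?S. {M \<in> set_pmf \<mu>. (c, v) \<in> M})"
      by (subst (asm) measure_pmf.prob_eq_1) auto
    then show ?thesis
      using MM by (auto simp: AE_measure_pmf_iff)
  qed
  have "measure_pmf.expectation \<mu>
          (\<lambda>M. \<Prod>v\<in>T. if matched_color M v = Some c then 1 else exp (g v))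
        \<le> (\<Prod>v\<in>T. exp (g v + (exp (- g v) - 1) / D v))"
    if T: "T \<subseteq> N" "\<And>v. v \<in> T \<Longrightarrow> (c, v) \<in> H" for c T g
  proof -
    have finT: "finite T" using T fin finite_subset by auto
    have "measure_pmf.expectation \<mu>
          (\<lambda>M. \<Prod>v\<in>T. if matched_color M v = Some c then 1 else exp (g v)) =
      measure_pmf.expectation \<mu>
          (\<lambda>M. (\<Prod>v\<in>T. exp (g v)) *
             (1 + (\<Sum>v\<in>T. indicator {M. (c, v) \<in> M} M * (exp (- g v) - 1))))"
    proof (rule integral_cong_AE; (simp add: AE_measure_pmf_iff; intro ballI)?)
      fix M assume MM: "M \<in> set_pmf \<mu>"
      show "(\<Prod>v\<in>T. if matched_color M v = Some c then 1 else exp (g v)) =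
          (\<Prod>v\<in>T. exp (g v)) *
             (1 + (\<Sum>v\<in>T. indicator {M. (c, v) \<in> M} M * (exp (- g v) - 1)))"
      proof (cases "\<exists>v\<in>T. (c, v) \<in> M")
        case False
        then have "(\<Prod>v\<in>T. if matched_color M v = Some c then 1 else exp (g v)) = (\<Prod>v\<in>T. exp (g v))"
          by (intro prod.cong) (auto simp: matched_color_eq_Some_iff[OF M[OF MM]])
        moreover have "(\<Sum>v\<in>T. indicator {M. (c, v) \<in> M} M * (exp (- g v) - 1)) = 0"
          using False by (intro sum.neutral) auto
        ultimately show ?thesis by simp
      next
        case True
        then obtain v where v: "v \<in> T" "(c, v) \<in> M" by auto
        have uniq: "(c, v') \<in> M \<longleftrightarrow> v' = v" for v'
          using M[OF MM] v unfolding bipartite_matching_def by fastforce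
        have "(\<Prod>v\<in>T. if matched_color M v = Some c then 1 else exp (g v)) =
            (\<Prod>v'\<in>T - {v}. exp (g v'))"
          using finT v by (subst prod.remove[of T v])
            (auto simp: matched_color_eq_Some_iff[OF M[OF MM]] uniq intro!: prod.cong)
        moreover have "(\<Sum>v\<in>T. indicator {M. (c, v) \<in> M} M * (exp (- g v) - 1)) =
            exp (- g v) - 1"
          using finT v by (subst sum.remove[of T v]) (auto simp: uniq intro!: sum.neutral)
        moreover have "(\<Prod>v\<in>T. exp (g v)) = exp (g v) * (\<Prod>v'\<in>T - {v}. exp (g v'))"
          using finT v by (simp add: prod.remove)
        ultimately show ?thesis by (simp add: exp_minus)
      qed
    qed
    also have "\<dots> = (\<Prod>v\<in>T. exp (g v)) * (1 + (\<Sum>v\<in>T. (exp (- g v) - 1) / D v))"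
    proof -
      have "measure_pmf.expectation \<mu> (\<lambda>M. \<Sum>v\<in>T. indicator {M. (c, v) \<in> M} M * (exp (- g v) - 1)) =
          (\<Sum>v\<in>T. (exp (- g v) - 1) / D v)"
        using T(2) by (subst Bochner_Integration.integral_sum) (auto simp: int prob x)
      then show ?thesis
        by (simp add: Bochner_Integration.integral_add int)
    qed
    also have "\<dots> \<le> (\<Prod>v\<in>T. exp (g v)) * exp (\<Sum>v\<in>T. (exp (- g v) - 1) / D v)"
      by (intro mult_left_mono exp_ge_add_one_self prod_nonneg) auto
    also have "\<dots> = (\<Prod>v\<in>T. exp (g v + (exp (- g v) - 1) / D v))"
      using finT by (simp add: exp_sum exp_add prod.distrib)
    finally show ?thesis .
  qed
  moreover have "if v \<in> N then \<exists>c. matched_color M v = Some c \<and> (c, v) \<in> H else matched_color M v = None"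
    if "M \<in> set_pmf \<mu>" for M v
  proof (cases "v \<in> N")
    case True
    with matched[OF True that] MH[OF that] show ?thesis
      by (auto simp: matched_color_eq_Some_iff[OF M[OF that]])
  next
    case False
    then have "\<nexists>c. (c, v) \<in> M" using MH[OF that] sub by blast
    with False show ?thesis by (simp add: matched_color_def)
  qed
  ultimately show ?thesis
    using finmu by (simp add: fair_choice_def)
qed

text \<open>Independence factorizes the expectation, and each factor is \<open>exp (g v)\<close>
  times \<open>1 + (exp (- g v) - 1) / D v\<close>, to which 1 + y \<le> exp y applies. This gives
  the same bound as for disjoint events.\<close>

lemma fair_choice_independent:
  fixes D :: "'a \<Rightarrow> real"
  assumes fin: "finite H" "finite N"
    and D: "\<And>v. v \<in> N \<Longrightarrow> D v > 0" "\<And>v. v \<in> N \<Longrightarrow> real (card {c. (c, v) \<in> H}) = D v"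
  shows "fair_choice H N D (Pi_pmf N None (\<lambda>v. map_pmf Some (pmf_of_set {c. (c, v) \<in> H})))"
    (is "fair_choice H N D (Pi_pmf N None ?p)")
proof -
  have finS: "finite {c. (c, v) \<in> H}" for v
    by (rule finite_subset[of _ "fst ` H"]) (use fin in force)+
  have neS: "{c. (c, v) \<in> H} \<noteq> {}" if "v \<in> N" for v
    using D[OF that] by (metis card.empty less_irrefl of_nat_0)
  have set: "set_pmf (?p v) = Some ` {c. (c, v) \<in> H}" if "v \<in> N" for v
    using finS neS[OF that] by simp
  have supp: "set_pmf (Pi_pmf N None ?p) = PiE_dflt N None (set_pmf \<circ> ?p)"
    using fin by (intro set_Pi_pmf)
  have finsupp: "finite (set_pmf (Pi_pmf N None ?p))"
    unfolding supp using fin set finS by (intro finite_PiE_dflt) auto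
  have "measure_pmf.expectation (Pi_pmf N None ?p)
          (\<lambda>f. \<Prod>v\<in>T. if f v = Some c then 1 else exp (g v))
        \<le> (\<Prod>v\<in>T. exp (g v + (exp (- g v) - 1) / D v))"
    if T: "T \<subseteq> N" "\<And>v. v \<in> T \<Longrightarrow> (c, v) \<in> H" for c T g
  proof -
    \<comment> \<open>Padding with factors 1 outside \<open>T\<close> makes the product range over
      all of \<open>N\<close>, the index set of the product distribution.\<close>
    define h where "h v y = (if v \<in> T then if y = Some c then 1 else exp (g v) else 1)" for v y
    have hT: "(\<Prod>v\<in>T. F v) = (\<Prod>v\<in>N. if v \<in> T then F v else 1)" for F :: "'a \<Rightarrow> real"
      using T(1) fin(2) by (simp add: prod.inter_restrict[symmetric] Int_absorb1)
    have "(\<lambda>f. \<Prod>v\<in>T. if f v = Some c then 1 else exp (g v)) = (\<lambda>f. \<Prod>v\<in>N. h v (f v))"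
      unfolding hT h_def by simp
    then have "measure_pmf.expectation (Pi_pmf N None ?p)
          (\<lambda>f. \<Prod>v\<in>T. if f v = Some c then 1 else exp (g v)) =
        (\<Prod>v\<in>N. measure_pmf.expectation (?p v) (h v))"
      using fin(2) finS neS
      by (simp only:) (rule expectation_prod_Pi_pmf;
          auto intro!: integrable_measure_pmf_finite simp: h_def set_pmf_of_set)
    also have "\<dots> \<le> (\<Prod>v\<in>N. if v \<in> T then exp (g v + (exp (- g v) - 1) / D v) else 1)"
    proof (intro prod_mono conjI)
      fix v assume v: "v \<in> N"
      show "0 \<le> measure_pmf.expectation (?p v) (h v)"
        by (rule Bochner_Integration.integral_nonneg) (auto simp: h_def)
      show "measure_pmf.expectation (?p v) (h v) \<le>
          (if v \<in> T then exp (g v + (exp (- g v) - 1) / D v) else 1)"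
      proof (cases "v \<in> T")
        case True
        have int: "integrable (measure_pmf (pmf_of_set {c. (c, v) \<in> H})) F" for F :: "nat \<Rightarrow> real"
          by (rule integrable_measure_pmf_finite) (simp only: set_pmf_of_set[OF neS[OF v] finS] finS)
        have "measure_pmf.expectation (?p v) (h v) = measure_pmf.expectation (pmf_of_set {c. (c, v) \<in> H})
            (\<lambda>y. exp (g v) + (1 - exp (g v)) * indicator {c} y)"
          using True by (auto simp: h_def intro!: Bochner_Integration.integral_cong)
        also have "\<dots> = exp (g v) + (1 - exp (g v)) / D v"
          using finS[of v] neS[OF v] T(2)[OF True] D[OF v]
          by (subst Bochner_Integration.integral_add)
            (auto simp: measure_pmf_single int)
        also have "\<dots> = exp (g v) * (1 + (exp (- g v) - 1) / D v)"
          using D[OF v] by (simp add: field_simps exp_minus)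
        also have "\<dots> \<le> exp (g v) * exp ((exp (- g v) - 1) / D v)"
          by (intro mult_left_mono exp_ge_add_one_self) auto
        finally show ?thesis using True by (simp add: exp_add)
      qed (simp add: h_def)
    qed
    also have "\<dots> = (\<Prod>v\<in>T. exp (g v + (exp (- g v) - 1) / D v))"
      by (simp only: hT)
    finally show ?thesis .
  qed
  moreover have "if v \<in> N then \<exists>c. f v = Some c \<and> (c, v) \<in> H else f v = None"
    if "f \<in> set_pmf (Pi_pmf N None ?p)" for f v
    using that set unfolding supp PiE_dflt_def by auto
  ultimately show ?thesis
    using finsupp by (simp add: fair_choice_def)
qed

section \<open>Invariants of the coloring during a run\<close>

definition color_free :: "('a, 'b) coloring \<Rightarrow> 'a \<Rightarrow> nat \<Rightarrow> bool" where
  "color_free \<phi> v c \<longleftrightarrow> (\<forall>u. \<phi> (v, u) \<noteq> Some c)"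

text \<open>This is the half of properness that the failure mode can destroy: no color repeats at an
  arrived online node. The other half, at offline nodes, belongs to \<open>consistent\<close>, which
  both modes preserve.\<close>

definition rainbow :: "'b list \<Rightarrow> ('a, 'b) coloring \<Rightarrow> bool" where
  "rainbow us \<phi> \<longleftrightarrow>
     (\<forall>u\<in>set us. \<forall>v v' c. \<phi> (v, u) = Some c \<and> \<phi> (v', u) = Some c \<longrightarrow> v = v')"

locale bounded_degree =
  fixes \<Delta> q :: nat and E :: "('a \<times> 'b) set"
  assumes finite_edges: "finite E"
    and q_pos: "q > 0"
    and offline_degree: "card (online_nbrs E v) \<le> \<Delta>"
    and online_degree: "card (offline_nbrs E w) \<le> \<Delta>"
begin

abbreviation colors :: "nat set" where "colors \<equiv> {1..\<Delta> + q}"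

text \<open>The denominator of the marginals. By \<open>card_free_colors\<close> below it is also
  the number of colors still free at a neighbor of the arriving node.\<close>

definition slack :: "'b list \<Rightarrow> 'a \<Rightarrow> real" where
  "slack us v = real \<Delta> - real (degree_before E us v) + real q"

definition consistent :: "'b list \<Rightarrow> ('a, 'b) coloring \<Rightarrow> bool" where
  "consistent us \<phi> \<longleftrightarrow>
     (\<forall>v u. if (v, u) \<in> E \<and> u \<in> set us then \<exists>c\<in>colors. \<phi> (v, u) = Some c else \<phi> (v, u) = None) \<and>
     (\<forall>v u u' c. \<phi> (v, u) = Some c \<and> \<phi> (v, u') = Some c \<longrightarrow> u = u')"

text \<open>The exact condition under which the arrival of \<open>w\<close> triggers the failure
  mode.\<close>

definition congested :: "'b list \<Rightarrow> 'b \<Rightarrow> ('a, 'b) coloring \<Rightarrow> bool" where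
  "congested us w \<phi> \<longleftrightarrow>
     \<not> (\<forall>c\<in>colors. (\<Sum>v\<in>offline_nbrs E w.
          marginal \<Delta> q (degree_before E us) (color_graph colors E w \<phi>) c v) \<le> 1)"

lemma finite_offline_nbrs: "finite (offline_nbrs E w)"
  by (rule finite_subset[of _ "fst ` E"]) (use finite_edges in \<open>force simp: offline_nbrs_def\<close>)+

lemma finite_online_nbrs: "finite (online_nbrs E v)"
  by (rule finite_subset[of _ "snd ` E"]) (use finite_edges in \<open>force simp: online_nbrs_def\<close>)+

lemma finite_color_graph: "finite (color_graph colors E w \<phi>)"
  by (rule finite_subset[of _ "colors \<times> offline_nbrs E w"])
    (auto simp: color_graph_def finite_offline_nbrs)

lemma degree_before_le: "degree_before E us v \<le> \<Delta>"
proof -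
  have "degree_before E us v \<le> card (online_nbrs E v)"
    unfolding degree_before_def
    by (rule card_mono) (auto simp: finite_online_nbrs, auto simp: online_nbrs_def)
  with offline_degree show ?thesis by (rule order_trans[rotated])
qed

lemma degree_before_snoc:
  assumes "w \<notin> set us"
  shows "degree_before E (us @ [w]) v = degree_before E us v + (if (v, w) \<in> E then 1 else 0)"
proof -
  have "{u \<in> set (us @ [w]). (v, u) \<in> E} =
      (if (v, w) \<in> E then insert w else id) {u \<in> set us. (v, u) \<in> E}"
    by auto
  then show ?thesis using assms by (simp add: degree_before_def)
qed

lemma slack_snoc:
  assumes "w \<notin> set us"
  shows "slack (us @ [w]) v = slack us v - (if (v, w) \<in> E then 1 else 0)"
  using degree_before_snoc[OF assms, of v] by (simp add: slack_def)

lemma slack_ge: "slack us v \<ge> real q"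
  using degree_before_le[of us v] by (simp add: slack_def)

lemma slack_ge_Suc:
  assumes "w \<notin> set us" "(v, w) \<in> E"
  shows "slack us v \<ge> real q + 1"
  using slack_ge[of "us @ [w]" v] slack_snoc[of w us v] assms by simp

text \<open>The edges of \<open>v\<close> to arrived nodes carry pairwise distinct colors, so
  exactly \<open>degree_before E us v\<close> of the \<Delta> + q colors are used up.\<close>

lemma card_free_colors:
  assumes "consistent us \<phi>" "v \<in> offline_nbrs E w"
  shows "real (card {c. (c, v) \<in> color_graph colors E w \<phi>}) = slack us v"
proof -
  let ?U = "{u \<in> set us. (v, u) \<in> E}"
  let ?used = "(\<lambda>u. the (\<phi> (v, u))) ` ?U"
  have 1: "\<exists>c\<in>colors. \<phi> (v, u) = Some c" if "(v, u) \<in> E" "u \<in> set us" for u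
    using assms(1) that unfolding consistent_def by metis
  have 2: "u \<in> ?U" if "\<phi> (v, u) = Some c" for u c
    using assms(1) that unfolding consistent_def by (metis (mono_tags, lifting) mem_Collect_eq option.distinct(1))
  have 3: "u = u'" if "\<phi> (v, u) = Some c" "\<phi> (v, u') = Some c" for u u' c
    using assms(1) that unfolding consistent_def by metis
  have inj: "inj_on (\<lambda>u. the (\<phi> (v, u))) ?U"
  proof (rule inj_onI)
    fix u u' assume u: "u \<in> ?U" "u' \<in> ?U" and eq: "the (\<phi> (v, u)) = the (\<phi> (v, u'))"
    from 1[of u] 1[of u'] u obtain c c' where "\<phi> (v, u) = Some c" "\<phi> (v, u') = Some c'"
      by auto
    with eq show "u = u'" by (auto intro: 3)
  qed
  have sub: "?used \<subseteq> colors"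
  proof
    fix c assume "c \<in> ?used"
    then obtain u where "(v, u) \<in> E" "u \<in> set us" "c = the (\<phi> (v, u))" by auto
    with 1[of u] show "c \<in> colors" by auto
  qed
  have "{c. (c, v) \<in> color_graph colors E w \<phi>} = colors - ?used"
  proof (intro equalityI subsetI)
    fix c assume "c \<in> {c. (c, v) \<in> color_graph colors E w \<phi>}"
    then have c: "c \<in> colors" "\<And>u. \<phi> (v, u) \<noteq> Some c"
      by (auto simp: color_graph_def)
    have "c \<notin> ?used"
    proof
      assume "c \<in> ?used"
      then obtain u where "(v, u) \<in> E" "u \<in> set us" "c = the (\<phi> (v, u))" by auto
      with 1[of u] c(2)[of u] show False by auto
    qed
    with c(1) show "c \<in> colors - ?used" by simp
  next
    fix c assume c: "c \<in> colors - ?used"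
    have "\<phi> (v, u) \<noteq> Some c" for u
    proof
      assume "\<phi> (v, u) = Some c"
      with 2[OF this] have "c \<in> ?used" by (intro image_eqI[of _ _ u]) auto
      with c show False by simp
    qed
    with c assms(2) show "c \<in> {c. (c, v) \<in> color_graph colors E w \<phi>}"
      by (simp add: color_graph_def)
  qed
  then have "card {c. (c, v) \<in> color_graph colors E w \<phi>} = \<Delta> + q - degree_before E us v"
    using sub inj by (simp add: card_Diff_subset card_image degree_before_def)
  then show ?thesis
    using degree_before_le[of us v] by (simp add: slack_def)
qed

section \<open>A single arrival\<close>

text \<open>This hides the mode in use. The analysis of the potential needs only the fair choice;
  injectivity of the chosen colors comes from the matching and is claimed only without
  congestion.\<close>

lemma algorithm_A_stepE:
  assumes step: "algorithm_A_step \<Delta> q E us w \<phi> Q"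
    and cons: "consistent us \<phi>" and w: "w \<notin> set us"
  obtains F where
    "Q = map_pmf (color_edges_at w \<phi>) F"
    "fair_choice (color_graph colors E w \<phi>) (offline_nbrs E w) (slack us) F"
    "\<And>f v v' c. \<not> congested us w \<phi> \<Longrightarrow> f \<in> set_pmf F \<Longrightarrow> f v = Some c \<Longrightarrow> f v' = Some c \<Longrightarrow> v = v'"
proof -
  let ?H = "color_graph colors E w \<phi>" and ?N = "offline_nbrs E w"
  let ?x = "marginal \<Delta> q (degree_before E us) ?H"
  have D: "slack us v > 0" "real (card {c. (c, v) \<in> ?H}) = slack us v" if "v \<in> ?N" for v
    using slack_ge[of us v] q_pos card_free_colors[OF cons that] by auto
  have sub: "v \<in> ?N" if "(c, v) \<in> ?H" for c v
    using that by (simp add: color_graph_def)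
  have x: "?x c v = (if (c, v) \<in> ?H then 1 / slack us v else 0)" for c v
    by (simp add: marginal_def slack_def)
  show thesis
  proof (cases "congested us w \<phi>")
    case True
    let ?F = "Pi_pmf ?N None (\<lambda>v. map_pmf Some (pmf_of_set {c. (c, v) \<in> ?H}))"
    have "Q = map_pmf (color_edges_at w \<phi>) ?F"
      using step True by (simp add: algorithm_A_step_def congested_def Let_def split: if_splits)
    then show thesis
      using that fair_choice_independent[OF finite_color_graph finite_offline_nbrs D] True by blast
  next
    case False
    then obtain \<mu> where mu: "matching_with_marginals ?H ?x \<mu>"
        "Q = map_pmf (\<lambda>M. color_edges_at w \<phi> (matched_color M)) \<mu>"
      using step by (auto simp: algorithm_A_step_def congested_def Let_def)
    have "v = v'" if "f \<in> set_pmf (map_pmf matched_color \<mu>)" "f v = Some c" "f v' = Some c" for f v v' c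
    proof -
      obtain M where M: "M \<in> set_pmf \<mu>" "f = matched_color M" using \<open>f \<in> _\<close> by auto
      then have bm: "bipartite_matching ?H M" using mu by (auto simp: matching_with_marginals_def)
      then have "(c, v) \<in> M" "(c, v') \<in> M"
        using that M by (simp_all add: matched_color_eq_Some_iff)
      then show ?thesis using bm unfolding bipartite_matching_def by fastforce
    qed
    moreover have "Q = map_pmf (color_edges_at w \<phi>) (map_pmf matched_color \<mu>)"
      using mu by (simp add: map_pmf_comp)
    moreover have "fair_choice ?H ?N (slack us) (map_pmf matched_color \<mu>)"
      using finite_color_graph finite_offline_nbrs sub D x mu(1) by (rule fair_choice_matching)
    ultimately show thesis using that by blast
  qed
qed

lemma fair_choiceD:
  assumes "fair_choice (color_graph colors E w \<phi>) (offline_nbrs E w) D F" "f \<in> set_pmf F"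
  shows "(v, w) \<in> E \<Longrightarrow> \<exists>c\<in>colors. f v = Some c \<and> color_free \<phi> v c"
    and "(v, w) \<notin> E \<Longrightarrow> f v = None"
    and "f v = Some c \<Longrightarrow> color_free \<phi> v c"
proof -
  have *: "if (v, w) \<in> E then \<exists>c. f v = Some c \<and> (c, v) \<in> color_graph colors E w \<phi> else f v = None"
    using assms by (auto simp: fair_choice_def offline_nbrs_def)
  then show 1: "(v, w) \<in> E \<Longrightarrow> \<exists>c\<in>colors. f v = Some c \<and> color_free \<phi> v c"
    and 2: "(v, w) \<notin> E \<Longrightarrow> f v = None"
    by (auto simp: color_graph_def color_free_def)
  show "f v = Some c \<Longrightarrow> color_free \<phi> v c"
    using 1 2 by (cases "(v, w) \<in> E") auto
qed

lemma consistent_step: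
  assumes cons: "consistent us \<phi>" and w: "w \<notin> set us"
    and F: "fair_choice (color_graph colors E w \<phi>) (offline_nbrs E w) D F" "f \<in> set_pmf F"
  shows "consistent (us @ [w]) (color_edges_at w \<phi> f)"
proof -
  have A: "if (v, u) \<in> E \<and> u \<in> set us then \<exists>c\<in>colors. \<phi> (v, u) = Some c else \<phi> (v, u) = None" for v u
    using cons unfolding consistent_def by blast
  have B: "u = u'" if "\<phi> (v, u) = Some c" "\<phi> (v, u') = Some c" for v u u' c
    using cons that unfolding consistent_def by blast
  have 1: "if (v, u) \<in> E \<and> u \<in> set (us @ [w])
      then \<exists>c\<in>colors. color_edges_at w \<phi> f (v, u) = Some c
      else color_edges_at w \<phi> f (v, u) = None" for v u
    using A[of v u] fair_choiceD(1,2)[OF F, of v] w by (auto simp: color_edges_at_def)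
  have 2: "u = u'" if "color_edges_at w \<phi> f (v, u) = Some c" "color_edges_at w \<phi> f (v, u') = Some c"
    for v u u' c
    using that fair_choiceD(3)[OF F, of v c] B[of v u c u']
    by (auto simp: color_edges_at_def color_free_def split: if_splits)
  show ?thesis unfolding consistent_def using 1 2 by blast
qed

lemma rainbow_step:
  assumes "rainbow us \<phi>" "\<And>v v' c. f v = Some c \<Longrightarrow> f v' = Some c \<Longrightarrow> v = v'"
  shows "rainbow (us @ [w]) (color_edges_at w \<phi> f)"
  using assms unfolding rainbow_def color_edges_at_def by auto

text \<open>The edge to \<open>w\<close> was uncolored before, so overwriting it cannot make a used
  color free again.\<close>

lemma color_free_step:
  assumes cons: "consistent us \<phi>" and w: "w \<notin> set us"
  shows "color_free (color_edges_at w \<phi> f) v c \<longleftrightarrow> color_free \<phi> v c \<and> f v \<noteq> Some c"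
proof -
  have "\<phi> (v, w) = None"
    using cons w unfolding consistent_def by metis
  then have "\<phi> (v, w) \<noteq> Some c" by simp
  then show ?thesis
    unfolding color_free_def color_edges_at_def prod.case by metis
qed

section \<open>The supermartingale\<close>

text \<open>An exponential weight for the load that \<open>c\<close> would put on \<open>w'\<close>,
  where \<open>w'\<close> is an arbitrary online node and not necessarily the one that arrives next.
  Neighbors that have already used \<open>c\<close> contribute a factor 1.\<close>

definition potential :: "(real \<Rightarrow> real) \<Rightarrow> 'b list \<Rightarrow> 'b \<Rightarrow> nat \<Rightarrow> ('a, 'b) coloring \<Rightarrow> real" where
  "potential h us w' c \<phi> =
     (\<Prod>v\<in>offline_nbrs E w'. if color_free \<phi> v c then exp (h (slack us v)) else 1)"

lemma potential_nonneg: "potential h us w' c \<phi> \<ge> 0"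
  by (auto simp: potential_def intro!: prod_nonneg)

text \<open>Only common neighbors of \<open>w\<close> and \<open>w'\<close> at which
  \<open>c\<close> is free change their factor: it becomes 1 if \<open>c\<close> is used, and
  otherwise the slack D drops to D - 1. The moment bound of \<open>fair_choice\<close> and the
  hypothesis on \<open>h\<close> show that these changes do not increase the expected
  product.\<close>

lemma potential_step:
  assumes h: "\<And>D. D \<ge> real q + 1 \<Longrightarrow> h (D - 1) + (exp (- h (D - 1)) - 1) / D \<le> h D"
    and step: "algorithm_A_step \<Delta> q E us w \<phi> Q"
    and cons: "consistent us \<phi>" and w: "w \<notin> set us" and c: "c \<in> colors"
  shows "measure_pmf.expectation Q (potential h (us @ [w]) w' c) \<le> potential h us w' c \<phi>"
proof -
  obtain F where F: "Q = map_pmf (color_edges_at w \<phi>) F"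
      "fair_choice (color_graph colors E w \<phi>) (offline_nbrs E w) (slack us) F"
    using algorithm_A_stepE[OF step cons w] by metis
  define A where "A = offline_nbrs E w'"
  define T where "T = {v \<in> A. (v, w) \<in> E \<and> color_free \<phi> v c}"
  define old where "old v = (if color_free \<phi> v c then exp (h (slack us v)) else 1)" for v
  define g where "g v = h (slack us v - 1)" for v
  have finA: "finite A" and TA: "T \<subseteq> A" by (auto simp: A_def T_def finite_offline_nbrs)
  have "potential h (us @ [w]) w' c (color_edges_at w \<phi> f) =
      (\<Prod>v\<in>A - T. old v) * (\<Prod>v\<in>T. if f v = Some c then 1 else exp (g v))"
    if f: "f \<in> set_pmf F" for f
  proof -
    have "potential h (us @ [w]) w' c (color_edges_at w \<phi> f) =
        (\<Prod>v\<in>A. if v \<in> T then if f v = Some c then 1 else exp (g v) else old v)"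
      unfolding potential_def A_def[symmetric]
      using fair_choiceD(2,3)[OF F(2) f]
      by (intro prod.cong)
        (auto simp: color_free_step[OF cons w] slack_snoc[OF w] T_def g_def old_def)
    also have "\<dots> = (\<Prod>v\<in>A - T. old v) * (\<Prod>v\<in>T. if f v = Some c then 1 else exp (g v))"
      by (subst prod.subset_diff[OF TA finA]) simp
    finally show ?thesis .
  qed
  then have "measure_pmf.expectation Q (potential h (us @ [w]) w' c) =
      measure_pmf.expectation F
        (\<lambda>f. (\<Prod>v\<in>A - T. old v) * (\<Prod>v\<in>T. if f v = Some c then 1 else exp (g v)))"
    unfolding F(1) integral_map_pmf by (intro integral_cong_AE) (auto simp: AE_measure_pmf_iff)
  also have "\<dots> = (\<Prod>v\<in>A - T. old v) *
      measure_pmf.expectation F (\<lambda>f. \<Prod>v\<in>T. if f v = Some c then 1 else exp (g v))"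
    by simp
  also have "\<dots> \<le> (\<Prod>v\<in>A - T. old v) * (\<Prod>v\<in>T. exp (g v + (exp (- g v) - 1) / slack us v))"
  proof (rule mult_left_mono)
    have "T \<subseteq> offline_nbrs E w" "\<forall>v\<in>T. (c, v) \<in> color_graph colors E w \<phi>"
      using c by (auto simp: T_def offline_nbrs_def color_graph_def color_free_def)
    then show "measure_pmf.expectation F (\<lambda>f. \<Prod>v\<in>T. if f v = Some c then 1 else exp (g v))
        \<le> (\<Prod>v\<in>T. exp (g v + (exp (- g v) - 1) / slack us v))"
      using F(2) unfolding fair_choice_def by blast
  qed (auto intro!: prod_nonneg simp: old_def)
  also have "\<dots> \<le> (\<Prod>v\<in>A - T. old v) * (\<Prod>v\<in>T. old v)"
  proof (intro mult_left_mono prod_mono conjI)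
    fix v assume "v \<in> T"
    \<comment> \<open>The edge to \<open>w\<close> is not yet counted in the slack, which is thus at
      least 1 above its minimum q. This is the range in which the hypothesis on \<open>h\<close>
      applies.\<close>
    then have "slack us v \<ge> real q + 1" and "color_free \<phi> v c"
      using slack_ge_Suc[OF w] by (auto simp: T_def)
    then show "exp (g v + (exp (- g v) - 1) / slack us v) \<le> old v"
      using h[of "slack us v"] by (simp add: g_def old_def)
  qed (auto intro!: prod_nonneg simp: old_def)
  also have "\<dots> = potential h us w' c \<phi>"
    unfolding potential_def A_def[symmetric] old_def[symmetric]
    by (rule prod.subset_diff[OF TA finA, symmetric])
  finally show ?thesis .
qed

lemma algorithm_A_consistent:
  assumes "algorithm_A \<Delta> q E us P" "distinct us"
  shows "finite (set_pmf P)" "\<phi> \<in> set_pmf P \<Longrightarrow> consistent us \<phi>"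
proof -
  have "finite (set_pmf P) \<and> (\<forall>\<phi>\<in>set_pmf P. consistent us \<phi>)"
    using assms
  proof induction
    case start
    then show ?case by (simp add: consistent_def)
  next
    case (arrival us P w K)
    then have IH: "finite (set_pmf P)" "\<And>\<phi>. \<phi> \<in> set_pmf P \<Longrightarrow> consistent us \<phi>"
      and w: "w \<notin> set us" by auto
    have "finite (set_pmf (K \<phi>)) \<and> (\<forall>\<psi>\<in>set_pmf (K \<phi>). consistent (us @ [w]) \<psi>)"
      if phi: "\<phi> \<in> set_pmf P" for \<phi>
    proof -
      obtain F where F: "K \<phi> = map_pmf (color_edges_at w \<phi>) F"
          "fair_choice (color_graph colors E w \<phi>) (offline_nbrs E w) (slack us) F"
        using algorithm_A_stepE[OF arrival.hyps(2)[OF phi] IH(2)[OF phi] w] by metis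
      have "finite (set_pmf F)" using F(2) by (simp add: fair_choice_def)
      then show ?thesis
        using consistent_step[OF IH(2)[OF phi] w F(2)] F(1) by auto
    qed
    then show ?case using IH(1) by auto
  qed
  then show "finite (set_pmf P)" "\<phi> \<in> set_pmf P \<Longrightarrow> consistent us \<phi>" by auto
qed

text \<open>The supermartingale property bounds the expectation by the initial value, where
  \<open>c\<close> is free everywhere and each of the at most \<Delta> neighbors of
  \<open>w'\<close> has slack \<Delta> + q.\<close>

lemma expectation_potential_le:
  assumes h: "\<And>D. D \<ge> real q + 1 \<Longrightarrow> h (D - 1) + (exp (- h (D - 1)) - 1) / D \<le> h D"
    and h0: "h (real \<Delta> + real q) \<ge> 0"
    and c: "c \<in> colors" and run: "algorithm_A \<Delta> q E us P" "distinct us"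
  shows "measure_pmf.expectation P (potential h us w' c) \<le> exp (real \<Delta> * h (real \<Delta> + real q))"
  using run
proof induction
  case start
  have "potential h [] w' c (\<lambda>_. None) = exp (real (card (offline_nbrs E w')) * h (real \<Delta> + real q))"
    by (simp add: potential_def color_free_def slack_def degree_before_def exp_of_nat_mult)
  also have "\<dots> \<le> exp (real \<Delta> * h (real \<Delta> + real q))"
    using online_degree[of w'] h0 by (simp add: mult_right_mono)
  finally show ?case by simp
next
  case (arrival us P w K)
  then have w: "w \<notin> set us" and dist: "distinct us" by auto
  \<comment> \<open>For \<phi> in the support of \<open>P\<close>, the support of
    \<open>K \<phi>\<close> lies in that of the composed distribution, so finiteness passes to
    it.\<close>
  have fin': "finite (set_pmf (bind_pmf P K))"
    using algorithm_A_consistent(1)[OF algorithm_A.arrival[OF arrival.hyps(1,2)] arrival.prems] by simp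
  note inv = algorithm_A_consistent[OF arrival.hyps(1) dist]
  have "measure_pmf.expectation (bind_pmf P K) (potential h (us @ [w]) w' c) =
      measure_pmf.expectation P (\<lambda>\<phi>. measure_pmf.expectation (K \<phi>) (potential h (us @ [w]) w' c))"
    using fin' inv(1) by (intro expectation_bind_pmf_finite) (auto intro: finite_subset)
  also have "\<dots> \<le> measure_pmf.expectation P (potential h us w' c)"
    using inv(1) potential_step[OF h arrival.hyps(2) inv(2) w c]
    by (intro expectation_mono_finite)
  also have "\<dots> \<le> exp (real \<Delta> * h (real \<Delta> + real q))"
    using arrival.IH dist by simp
  finally show ?case .
qed

section \<open>From the potential to the failure probability\<close>

text \<open>A congested color has a sum of \<open>1 / slack us v\<close> over its free neighbors
  exceeding 1. As \<open>h\<close> dominates \<open>l / D\<close>, the logarithm of its potential is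
  at least \<open>l\<close> times this sum.\<close>

lemma potential_ge_if_congested:
  assumes h: "\<And>D. D \<ge> real q \<Longrightarrow> l / D \<le> h D" and l: "l \<ge> 0"
    and "congested us w \<phi>"
  obtains c where "c \<in> colors" "potential h us w c \<phi> \<ge> exp l"
proof -
  let ?N = "offline_nbrs E w"
  obtain c where c: "c \<in> colors"
      "(\<Sum>v\<in>?N. marginal \<Delta> q (degree_before E us) (color_graph colors E w \<phi>) c v) > 1"
    using assms(3) by (auto simp: congested_def not_le)
  have "l \<le> l * (\<Sum>v\<in>?N. marginal \<Delta> q (degree_before E us) (color_graph colors E w \<phi>) c v)"
    using c(2) l mult_left_mono[of 1 _ l] by simp
  also have "\<dots> = (\<Sum>v\<in>?N. if color_free \<phi> v c then l / slack us v else 0)"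
    unfolding sum_distrib_left using c(1)
    by (intro sum.cong) (auto simp: marginal_def color_graph_def color_free_def slack_def)
  also have "\<dots> \<le> (\<Sum>v\<in>?N. if color_free \<phi> v c then h (slack us v) else 0)"
    using h slack_ge by (intro sum_mono) auto
  finally have "exp l \<le> exp (\<Sum>v\<in>?N. if color_free \<phi> v c then h (slack us v) else 0)"
    by simp
  also have "\<dots> = potential h us w c \<phi>"
    by (simp add: potential_def exp_sum finite_offline_nbrs if_distrib cong: if_cong)
  finally show ?thesis using that c(1) by blast
qed

text \<open>The two inequalities have opposite purposes: \<open>h_step\<close> keeps the expected
  potential small, while \<open>h_ge\<close> forces it to be at least \<open>exp l\<close> at a
  failure. The explicit \<open>h\<close> and \<open>l\<close> are chosen only in
  \<open>prob_proper_ge\<close>.\<close>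

context
  fixes h :: "real \<Rightarrow> real" and l :: real
  assumes h_step: "\<And>D. D \<ge> real q + 1 \<Longrightarrow> h (D - 1) + (exp (- h (D - 1)) - 1) / D \<le> h D"
    and h_ge: "\<And>D. D \<ge> real q \<Longrightarrow> l / D \<le> h D" and l_nonneg: "l \<ge> 0"
begin

text \<open>Markov's inequality for the potential of each color, followed by a union bound over the
  colors.\<close>

lemma prob_congested_le:
  assumes run: "algorithm_A \<Delta> q E us P" "distinct us"
  shows "measure_pmf.prob P {\<phi>. congested us w \<phi>}
    \<le> real (\<Delta> + q) * exp (real \<Delta> * h (real \<Delta> + real q) - l)"
proof -
  have h0: "h (real \<Delta> + real q) \<ge> 0"
    using h_ge[of "real \<Delta> + real q"] l_nonneg q_pos
    by (meson divide_nonneg_nonneg le_add_same_cancel2 of_nat_0_le_iff order_trans add_nonneg_nonneg)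
  have "measure_pmf.prob P {\<phi>. congested us w \<phi>}
      \<le> measure_pmf.prob P (\<Union>c\<in>colors. {\<phi>. potential h us w c \<phi> \<ge> exp l})"
  proof (rule measure_pmf.finite_measure_mono)
    show "{\<phi>. congested us w \<phi>} \<subseteq> (\<Union>c\<in>colors. {\<phi>. potential h us w c \<phi> \<ge> exp l})"
    proof
      fix \<phi> assume "\<phi> \<in> {\<phi>. congested us w \<phi>}"
      then obtain c where "c \<in> colors" "potential h us w c \<phi> \<ge> exp l"
        using potential_ge_if_congested[OF h_ge l_nonneg] by blast
      then show "\<phi> \<in> (\<Union>c\<in>colors. {\<phi>. potential h us w c \<phi> \<ge> exp l})" by blast
    qed
  qed simp
  also have "\<dots> \<le> (\<Sum>c\<in>colors. measure_pmf.prob P {\<phi>. potential h us w c \<phi> \<ge> exp l})"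
    by (intro measure_pmf.finite_measure_subadditive_finite) auto
  also have "\<dots> \<le> (\<Sum>c\<in>colors. exp (real \<Delta> * h (real \<Delta> + real q) - l))"
  proof (rule sum_mono)
    fix c assume c: "c \<in> colors"
    have "measure_pmf.prob P {\<phi>. potential h us w c \<phi> \<ge> exp l}
        \<le> measure_pmf.expectation P (potential h us w c) / exp l"
      using integral_Markov_inequality_measure[of "measure_pmf P" "potential h us w c" "{}" "exp l"]
        integrable_measure_pmf_finite[OF algorithm_A_consistent(1)[OF run], of "potential h us w c"]
        potential_nonneg[of h us w c]
      by simp
    also have "\<dots> \<le> exp (real \<Delta> * h (real \<Delta> + real q)) / exp l"
      using expectation_potential_le[OF h_step h0 c run] by (intro divide_right_mono) auto
    finally show "measure_pmf.prob P {\<phi>. potential h us w c \<phi> \<ge> exp l}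
        \<le> exp (real \<Delta> * h (real \<Delta> + real q) - l)"
      by (simp add: exp_diff)
  qed
  also have "\<dots> = real (\<Delta> + q) * exp (real \<Delta> * h (real \<Delta> + real q) - l)"
    by simp
  finally show ?thesis .
qed

text \<open>A color can repeat at an online node only if it did so before or if the new node is
  congested on arrival. Each arrival thus adds at most one failure probability, without any
  conditioning on earlier success.\<close>

lemma prob_not_rainbow_le:
  assumes run: "algorithm_A \<Delta> q E us P" "distinct us"
  shows "measure_pmf.prob P {\<phi>. \<not> rainbow us \<phi>}
    \<le> real (length us) * (real (\<Delta> + q) * exp (real \<Delta> * h (real \<Delta> + real q) - l))"
    (is "_ \<le> real (length us) * ?\<epsilon>")
  using run
proof induction
  case start
  then show ?case by (simp add: rainbow_def)
next
  case (arrival us P w K)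
  then have w: "w \<notin> set us" and dist: "distinct us" by auto
  have fin': "finite (set_pmf (bind_pmf P K))"
    using algorithm_A_consistent(1)[OF algorithm_A.arrival[OF arrival.hyps(1,2)] arrival.prems] by simp
  note inv = algorithm_A_consistent[OF arrival.hyps(1) dist]
  note int = integrable_measure_pmf_finite[OF inv(1)]
  let ?B = "{\<phi>. \<not> rainbow us \<phi>}" and ?B' = "{\<phi>. \<not> rainbow (us @ [w]) \<phi>}"
    and ?O = "{\<phi>. congested us w \<phi>}"
  have le: "measure_pmf.prob (K \<phi>) ?B' \<le> indicator ?B \<phi> + indicator ?O \<phi>" if phi: "\<phi> \<in> set_pmf P" for \<phi>
  proof (cases "rainbow us \<phi> \<and> \<not> congested us w \<phi>")
    case True
    obtain F where F: "K \<phi> = map_pmf (color_edges_at w \<phi>) F"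
      "\<And>f v v' c. f \<in> set_pmf F \<Longrightarrow> f v = Some c \<Longrightarrow> f v' = Some c \<Longrightarrow> v = v'"
      using algorithm_A_stepE[OF arrival.hyps(2)[OF phi] inv(2)[OF phi] w] True by metis
    have "\<psi> \<notin> ?B'" if "\<psi> \<in> set_pmf (K \<phi>)" for \<psi>
      using that rainbow_step[of us \<phi>] F True by auto
    then have "measure_pmf.prob (K \<phi>) ?B' = 0"
      by (subst measure_pmf_zero_iff) auto
    then show ?thesis by simp
  next
    case False
    then have "(1::real) \<le> indicator ?B \<phi> + indicator ?O \<phi>" by (auto simp: indicator_def)
    then show ?thesis using measure_pmf.prob_le_1[of "K \<phi>" ?B'] by linarith
  qed
  have "measure_pmf.prob (bind_pmf P K) ?B' = measure_pmf.expectation (bind_pmf P K) (indicator ?B')"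
    by simp
  also have "\<dots> = measure_pmf.expectation P (\<lambda>\<phi>. measure_pmf.expectation (K \<phi>) (indicator ?B'))"
    using fin' inv(1) by (intro expectation_bind_pmf_finite) (auto intro: finite_subset)
  also have "\<dots> \<le> measure_pmf.expectation P (\<lambda>\<phi>. indicator ?B \<phi> + indicator ?O \<phi>)"
    using inv(1) le by (intro expectation_mono_finite) auto
  also have "\<dots> = measure_pmf.prob P ?B + measure_pmf.prob P ?O"
    by (subst Bochner_Integration.integral_add) (auto intro: int)
  also have "\<dots> \<le> real (length us) * ?\<epsilon> + ?\<epsilon>"
    using arrival.IH dist prob_congested_le[OF arrival.hyps(1) dist] by (intro add_mono) auto
  also have "\<dots> = real (length (us @ [w])) * ?\<epsilon>"
    by (simp add: algebra_simps)
  finally show ?case .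
qed

end

lemma proper_if_rainbow:
  assumes cons: "consistent ws \<phi>" and rainbow: "rainbow ws \<phi>" and E: "snd ` E \<subseteq> set ws"
  shows "proper_edge_coloring E colors \<phi>"
proof -
  have 1: "\<exists>c\<in>colors. \<phi> e = Some c" if "e \<in> E" for e
    using cons that E unfolding consistent_def by (metis image_subset_iff prod.collapse)
  have 2: "\<phi> e \<noteq> \<phi> e'" if e: "e \<in> E" "e' \<in> E" "e \<noteq> e'" "fst e = fst e' \<or> snd e = snd e'" for e e'
  proof
    assume eq: "\<phi> e = \<phi> e'"
    obtain v u v' u' where vu: "e = (v, u)" "e' = (v', u')" by (metis prod.collapse)
    obtain c where c: "\<phi> e = Some c" using 1[OF e(1)] by auto
    have "u \<in> set ws" using E e(1) vu by force
    from e(4) show False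
    proof
      assume "fst e = fst e'"
      then show False
        using cons c eq vu e(3) unfolding consistent_def by (metis fst_conv)
    next
      assume "snd e = snd e'"
      then show False
        using rainbow c eq vu e(3) \<open>u \<in> set ws\<close> unfolding rainbow_def by (metis snd_conv)
    qed
  qed
  show ?thesis unfolding proper_edge_coloring_def using 1 2 by blast
qed

end

section \<open>Real inequalities for the reciprocal function and for the number of extra
  colors\<close>

text \<open>
  To second order, the inequality required of \<open>h\<close> reads \<open>D h' \<ge> - h + h\<^sup>2 / 2\<close>. The function
  \<open>h(D) = 1 / (\<alpha> D + 1)\<close> solves \<open>D h' = - h + h\<^sup>2\<close>, which leaves room for the remainder.
\<close>

lemma reciprocal_supersolution:
  fixes \<alpha> D :: real
  assumes a: "0 \<le> \<alpha>" "\<alpha> \<le> 1" and D: "D > 1"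
  shows "1 / (\<alpha> * (D - 1) + 1) + (exp (- (1 / (\<alpha> * (D - 1) + 1))) - 1) / D \<le> 1 / (\<alpha> * D + 1)"
proof -
  define s where "s = \<alpha> * (D - 1) + 1"
  have s: "s > 0" "\<alpha> * D = s + \<alpha> - 1"
    using mult_nonneg_nonneg[of \<alpha> "D - 1"] a D by (auto simp: s_def algebra_simps)
  have "exp (- (1 / s)) = 1 / exp (1 / s)"
    by (simp add: exp_minus field_simps)
  \<comment> \<open>The bound exp (- y) \<le> 1 / (1 + y) has second-order term y^2 instead of y^2 /
    2; this is the room left by the choice of \<open>h\<close>, and it keeps everything
    rational.\<close>
  also have "\<dots> \<le> 1 / (1 + 1 / s)"
    using s exp_ge_add_one_self[of "1 / s"] by (intro divide_left_mono) (auto intro!: mult_pos_pos add_pos_pos)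
  also have "\<dots> = 1 - 1 / (s + 1)"
    using s by (simp add: field_simps)
  finally have "(exp (- (1 / s)) - 1) / D \<le> - (1 / (s + 1)) / D"
    using D by (intro divide_right_mono) auto
  moreover have "1 / s - 1 / (s + \<alpha>) \<le> 1 / (s + 1) / D"
  proof -
    have "1 / s - 1 / (s + \<alpha>) = \<alpha> / (s * (s + \<alpha>))"
      using s a by (simp add: field_simps)
    also have "\<dots> \<le> 1 / ((s + 1) * D)"
    proof -
      \<comment> \<open>The two sides differ by exactly 1 - \<alpha>, which is where \<alpha> \<le>
        1 enters.\<close>
      have "\<alpha> * D * (s + 1) = s * (s + \<alpha>) + (\<alpha> - 1)"
        unfolding s(2) by (simp add: algebra_simps)
      then have "\<alpha> * D * (s + 1) \<le> s * (s + \<alpha>)"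
        using a by simp
      then show ?thesis
        using s a D by (simp add: divide_simps mult_ac)
    qed
    finally show ?thesis by (simp add: field_simps)
  qed
  moreover have "\<alpha> * D + 1 = s + \<alpha>"
    using s(2) by simp
  ultimately show ?thesis
    unfolding s_def[symmetric] by simp
qed

text \<open>The value x before rounding satisfies x^3 = 27 \<Delta>^2 ln n \<le> \<Delta>^3 because
  81 ln n \<le> \<Delta>. Rounding up does not exceed \<Delta>, which is an integer.\<close>

lemma extra_colors_bounds:
  fixes n \<Delta> q :: nat
  assumes n: "n \<ge> 2" and D: "\<Delta> > 0" "real \<Delta> \<ge> 81 * ln (real n)"
    and q: "q = nat \<lceil>3 * real \<Delta> powr (2/3) * ln (real n) powr (1/3)\<rceil>"
  shows "q > 0" "q \<le> \<Delta>" "real q ^ 3 \<ge> 27 * real \<Delta> ^ 2 * ln (real n)"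
proof -
  define x where "x = 3 * real \<Delta> powr (2/3) * ln (real n) powr (1/3)"
  have ln: "ln (real n) > 0" using n by simp
  have x0: "x > 0" using ln D by (simp add: x_def)
  have cube: "x ^ 3 = 27 * real \<Delta> ^ 2 * ln (real n)"
  proof -
    have "(real \<Delta> powr (2/3)) ^ 3 = real \<Delta> ^ 2" "(ln (real n) powr (1/3)) ^ 3 = ln (real n)"
      using D ln by (simp_all add: powr_power powr_numeral)
    then show ?thesis by (simp add: x_def power_mult_distrib)
  qed
  have qx: "real q \<ge> x" unfolding q x_def[symmetric] by linarith
  show "q > 0" using qx x0 by simp
  have "x ^ 3 \<le> real \<Delta> ^ 3"
  proof -
    have "x ^ 3 = 27 * ln (real n) * real \<Delta> ^ 2" by (simp add: cube)
    also have "\<dots> \<le> real \<Delta> * real \<Delta> ^ 2"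
      using D ln by (intro mult_right_mono) auto
    finally show ?thesis by (simp add: power3_eq_cube power2_eq_square)
  qed
  then have "x \<le> real \<Delta>"
    using power_mono_iff[of x "real \<Delta>" 3] x0 by simp
  then show "q \<le> \<Delta>"
    unfolding q x_def[symmetric] by (simp add: nat_le_iff ceiling_le_iff)
  show "real q ^ 3 \<ge> 27 * real \<Delta> ^ 2 * ln (real n)"
    using power_mono[OF qx, of 3] x0 cube by simp
qed

section \<open>Choice of the potential and the final estimate\<close>

lemma (in bounded_degree) prob_proper_ge:
  assumes run: "algorithm_A \<Delta> q E ws P" "distinct ws" and E: "snd ` E \<subseteq> set ws"
    and q: "q \<le> \<Delta>" "2 * \<Delta> \<le> q ^ 2"
  shows "measure_pmf.prob P {\<phi>. proper_edge_coloring E colors \<phi>}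
    \<ge> 1 - real (length ws) * (real (\<Delta> + q) * exp (- (real q ^ 3 / (2 * real \<Delta> * (2 * real \<Delta> + real q)))))"
proof -
  \<comment> \<open>Minimizing the exponent \<Delta> / (\<alpha> (\<Delta> + q) + 1) - q / (\<alpha>
    q + 1) over \<alpha> requires the ratio of the first denominator to the second to be sqrt
    (\<Delta> (\<Delta> + q)) / q. Replacing the square root by \<Delta> + q / 2 gives this
    rational, nearly optimal \<alpha>.\<close>
  define \<alpha> where "\<alpha> = (2 * real \<Delta> - real q) / real q ^ 2"
  define h where "h D = 1 / (\<alpha> * D + 1)" for D
  \<comment> \<open>Since D / (\<alpha> D + 1) increases with D, the largest \<open>l\<close> with
    \<open>l / D\<close> \<le> \<open>h D\<close> for all D \<ge> q is attained at D = q; it is q /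
    (\<alpha> q + 1).\<close>
  define l where "l = real q ^ 2 / (2 * real \<Delta>)"
  have D: "real \<Delta> > 0" "real q > 0" "real q \<le> real \<Delta>" using q q_pos by auto
  have q2: "2 * real \<Delta> \<le> real q ^ 2" using q(2) by (metis of_nat_le_iff of_nat_mult of_nat_numeral of_nat_power)
  \<comment> \<open>The lower bound uses q \<le> \<Delta>, the upper bound 2 \<Delta> \<le>
    q^2.\<close>
  have a: "\<alpha> \<ge> 0" "\<alpha> \<le> 1" using D q2 by (auto simp: \<alpha>_def divide_simps)
  have h_step: "h (x - 1) + (exp (- h (x - 1)) - 1) / x \<le> h x" if "x \<ge> real q + 1" for x
    unfolding h_def using reciprocal_supersolution[OF a, of x] that D by simp
  have l_eq: "l = real q / (\<alpha> * real q + 1)"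
    using D by (simp add: l_def \<alpha>_def field_simps power2_eq_square)
  have h_ge: "l / x \<le> h x" if x: "x \<ge> real q" for x
  proof -
    have "real q * (\<alpha> * x + 1) \<le> x * (\<alpha> * real q + 1)"
      using x by (simp add: algebra_simps)
    moreover have "\<alpha> * x + 1 > 0" "\<alpha> * real q + 1 > 0" "x > 0"
      using a D x by (auto intro!: add_nonneg_pos)
    ultimately show ?thesis
      unfolding l_eq h_def by (simp add: divide_simps mult_ac)
  qed
  have l0: "l \<ge> 0" using D by (simp add: l_def)
  have "\<alpha> * (real \<Delta> + real q) + 1 = real \<Delta> * (2 * real \<Delta> + real q) / real q ^ 2"
    using D by (simp add: \<alpha>_def field_simps power2_eq_square)
  then have "real \<Delta> * h (real \<Delta> + real q) = real q ^ 2 / (2 * real \<Delta> + real q)"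
    using D by (simp add: h_def)
  moreover have "real q ^ 2 / (2 * real \<Delta> + real q) - real q ^ 2 / (2 * real \<Delta>) =
      - (real q ^ 3 / (2 * real \<Delta> * (2 * real \<Delta> + real q)))"
    using D by (subst diff_frac_eq) (simp_all add: power2_eq_square power3_eq_cube algebra_simps)
  ultimately have ex: "real \<Delta> * h (real \<Delta> + real q) - l =
      - (real q ^ 3 / (2 * real \<Delta> * (2 * real \<Delta> + real q)))"
    by (simp add: l_def)
  note cons = algorithm_A_consistent[OF run]
  have "measure_pmf.prob P {\<phi>. \<not> proper_edge_coloring E colors \<phi>} \<le> measure_pmf.prob P {\<phi>. \<not> rainbow ws \<phi>}"
    using proper_if_rainbow[OF cons(2) _ E]
    by (intro measure_pmf.finite_measure_mono_AE) (auto simp: AE_measure_pmf_iff)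
  also have "\<dots> \<le> real (length ws) * (real (\<Delta> + q) * exp (real \<Delta> * h (real \<Delta> + real q) - l))"
    by (rule prob_not_rainbow_le[OF h_step h_ge l0 run])
  finally have "measure_pmf.prob P {\<phi>. \<not> proper_edge_coloring E colors \<phi>}
      \<le> real (length ws) * (real (\<Delta> + q) * exp (real \<Delta> * h (real \<Delta> + real q) - l))" .
  moreover have "measure_pmf.prob P {\<phi>. \<not> proper_edge_coloring E colors \<phi>} =
      1 - measure_pmf.prob P {\<phi>. proper_edge_coloring E colors \<phi>}"
    using measure_pmf.prob_compl[of "{\<phi>. proper_edge_coloring E colors \<phi>}" P]
    by (simp add: Compl_eq_Diff_UNIV[symmetric] Collect_neg_eq)
  ultimately show ?thesis unfolding ex by linarith
qed

theorem theorem2: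
  shows "\<exists>c::real. c > 0 \<and>
    (\<forall>(n::nat) (\<Delta>::nat) (q::nat) (L::'a set) (R::'b set) (E::('a \<times> 'b) set)
       (ws::'b list) (P::('a, 'b) coloring pmf).
       n > 0 \<longrightarrow> \<Delta> > 0 \<longrightarrow> real \<Delta> \<ge> 81 * ln (real n) \<longrightarrow>
       q = nat \<lceil>3 * real \<Delta> powr (2/3) * ln (real n) powr (1/3)\<rceil> \<longrightarrow>
       bipartite_graph L R E \<longrightarrow> card L + card R = n \<longrightarrow> max_degree L R E = \<Delta> \<longrightarrow>
       distinct ws \<longrightarrow> set ws = R \<longrightarrow>
       algorithm_A \<Delta> q E ws P \<longrightarrow>
       measure_pmf.prob P {\<phi>. proper_edge_coloring E {1..\<Delta> + q} \<phi>} \<ge> 1 - real n powr (- c))"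
\<comment> \<open>The estimate below yields a failure probability of at most n powr (- 3/2), so the
  exponent 1 suffices.\<close>
proof (intro exI[of _ 1] conjI allI impI)
  fix n \<Delta> q :: nat and L :: "'a set" and R :: "'b set" and E :: "('a \<times> 'b) set"
    and ws :: "'b list" and P :: "('a, 'b) coloring pmf"
  assume n: "n > 0" and \<Delta>: "\<Delta> > 0" "real \<Delta> \<ge> 81 * ln (real n)"
    and q: "q = nat \<lceil>3 * real \<Delta> powr (2/3) * ln (real n) powr (1/3)\<rceil>"
    and bip: "bipartite_graph L R E" and card: "card L + card R = n"
    and deg: "max_degree L R E = \<Delta>"
    and ws: "distinct ws" "set ws = R" and run: "algorithm_A \<Delta> q E ws P"
  show "measure_pmf.prob P {\<phi>. proper_edge_coloring E {1..\<Delta> + q} \<phi>} \<ge> 1 - real n powr (- 1)"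
  proof (cases "n = 1")
    \<comment> \<open>For n = 1 the claimed lower bound is 0.\<close>
    case True
    then show ?thesis by simp
  next
    case False
    with n have n2: "n \<ge> 2" by simp
    note qb = extra_colors_bounds[OF n2 \<Delta> q]
    have LR: "finite L" "finite R" "E \<subseteq> L \<times> R" using bip by (auto simp: bipartite_graph_def)
    let ?degs = "(\<lambda>v. card (online_nbrs E v)) ` L \<union> (\<lambda>w. card (offline_nbrs E w)) ` R"
    have degs: "finite ?degs" "?degs \<noteq> {}" "\<Delta> = Max ?degs"
      using LR n card deg by (auto simp: max_degree_def)
    have nbrs: "online_nbrs E v \<subseteq> R" "offline_nbrs E w \<subseteq> L" for v w
      using LR by (auto simp: online_nbrs_def offline_nbrs_def)
    have "\<Delta> \<in> ?degs" using Max_in[OF degs(1,2)] degs(3) by simp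
    moreover have "card (online_nbrs E v) \<le> n" "card (offline_nbrs E w) \<le> n" for v w
      using card_mono[OF LR(2) nbrs(1), of v] card_mono[OF LR(1) nbrs(2), of w] card by simp_all
    ultimately have \<Delta>n: "\<Delta> \<le> n"
      by auto
    interpret bounded_degree \<Delta> q E
    proof
      show "finite E" using LR finite_subset by blast
      show "q > 0" by (rule qb)
      show "card (online_nbrs E v) \<le> \<Delta>" for v
      proof (cases "v \<in> L")
        case True
        then show ?thesis using degs by (auto intro: Max_ge)
      next
        case False
        then have "online_nbrs E v = {}" using LR by (auto simp: online_nbrs_def)
        then show ?thesis by simp
      qed
      show "card (offline_nbrs E w) \<le> \<Delta>" for w
      proof (cases "w \<in> R")
        case True
        then show ?thesis using degs by (auto intro: Max_ge)
      next
        case False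
        then have "offline_nbrs E w = {}" using LR by (auto simp: offline_nbrs_def)
        then show ?thesis by simp
      qed
    qed
    have "ln (real n) \<ge> ln 2" using n2 by simp
    then have ln: "ln (real n) \<ge> 1 / 2" using ln2_ge_two_thirds by linarith
    \<comment> \<open>By q \<le> \<Delta> and 27 ln n \<ge> 2, the product 2 \<Delta> q is at most
      27 \<Delta>^2 ln n \<le> q^3; one factor q is then cancelled.\<close>
    have q2: "2 * \<Delta> \<le> q ^ 2"
    proof -
      have "2 * real \<Delta> * real q \<le> 2 * real \<Delta> * real \<Delta>"
        using qb(2) by (intro mult_left_mono) auto
      also have "\<dots> \<le> (27 * ln (real n)) * real \<Delta> ^ 2"
        unfolding power2_eq_square mult.assoc[symmetric] using ln by (intro mult_right_mono) auto
      also have "\<dots> \<le> real q ^ 2 * real q"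
        using qb(3) by (simp add: power2_eq_square power3_eq_cube mult_ac)
      finally have "2 * real \<Delta> \<le> real q ^ 2" using qb(1) by simp
      then have "real (2 * \<Delta>) \<le> real (q ^ 2)" by simp
      then show ?thesis by (rule of_nat_le_iff[THEN iffD1])
    qed
    have "length ws \<le> n"
      using ws card distinct_card[OF ws(1)] by simp
    have expo: "exp (- (real q ^ 3 / (2 * real \<Delta> * (2 * real \<Delta> + real q)))) \<le> real n powr (- (9/2))"
    proof -
      \<comment> \<open>The constant is 27 / 6: the cube of q is at least 27 \<Delta>^2 ln n, and 2
        \<Delta> + q \<le> 3 \<Delta>.\<close>
      have "9/2 * ln (real n) = 27 * real \<Delta> ^ 2 * ln (real n) / (2 * real \<Delta> * (3 * real \<Delta>))"
        using \<Delta> by (simp add: power2_eq_square)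
      also have "\<dots> \<le> real q ^ 3 / (2 * real \<Delta> * (2 * real \<Delta> + real q))"
        using qb \<Delta> by (intro frac_le mult_left_mono) auto
      finally show ?thesis using n by (simp add: powr_def)
    qed
    have "real (length ws) * (real (\<Delta> + q) * exp (- (real q ^ 3 / (2 * real \<Delta> * (2 * real \<Delta> + real q)))))
        \<le> real n * ((real n * real n) * real n powr (- (9/2)))"
    proof -
      \<comment> \<open>Here \<Delta> + q \<le> 2 \<Delta> \<le> 2 n \<le> n^2, using n \<ge> 2.
        With at most n arrivals the union bound costs a factor n^3.\<close>
      have "\<Delta> + q \<le> n * n"
        using qb(2) \<Delta>n mult_le_mono1[OF n2, of n] by linarith
      then have "real (\<Delta> + q) \<le> real n * real n"
        by (metis of_nat_le_iff of_nat_mult)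
      then show ?thesis
        using \<open>length ws \<le> n\<close> expo by (intro mult_mono) auto
    qed
    also have "\<dots> = real n powr 3 * real n powr (- (9/2))"
      using n by (simp add: powr_numeral power3_eq_cube)
    also have "\<dots> \<le> real n powr (- 1)"
      unfolding powr_add[symmetric] using n by (intro powr_mono) auto
    finally show ?thesis
      using prob_proper_ge[OF run ws(1) _ qb(2) q2] ws(2) LR(3) by fastforce
  qed
qed simp

end
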